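(* Let $f:\mathbb R\to(0,\infty)$ be continuous, $1$-periodic, even and satisfy: (i) $f$ is differentiable on $(0,1)$; (ii) there are constants $C>0$ and $\varepsilon>0$ such that $f(t)\le f(0)-Ct$ for all $0\le t<\varepsilon$. Consider an $N$-point configuration $X=\{\mathbf x^0,\dots,\mathbf x^{N-1}\}\subseteq\mathbb T^d$ such that $x_1^0=\dots=x_1^j$ for some $j\ge1$ and $x_1^k\ne x_1^0$ for all $k>j$ (if such $k$ exist). For $r\in[-1/2,1/2)$ let $\mathbf x^0(r)=(x_1^0+r,x_2^0,\dots,x_d^0)$ and $$X_r=\{\mathbf x^0(r),\mathbf x^1,\dots,\mathbf x^{N-1}\}.$$ Then the function $r\mapsto E_F(X_r)$ does not have a local minimum at $r=0$.
   Context: $\mathbb T=\mathbb R/\mathbb Z$ is identified with $[0,1)$; points are written $\mathbf x^k=(x_1^k,\dots,x_d^k)\in\mathbb T^d$. Given $f$ and $d$, put $F(t_1,\dots,t_d)=f(t_1)\cdots f(t_d)$; for an $N$-point configuration (multiset) $X=\{\mathbf x^0,\dots,\mathbf x^{N-1}\}\subset\mathbb T^d$ the energy is $$E_F(X)=\sum_{k,\ell=0,\ k\ne\ell}^{N-1}\ \prod_{i=1}^d f(x_i^k-x_i^\ell).$$ *)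

theory Defs
  imports Complex_Main
begin

text \<open>
  A point of the \<open>d\<close>-dimensional torus is given by its coordinates with indices \<open>1..d\<close>, each
  represented in \<open>[0,1)\<close>; the values at other indices are irrelevant. An \<open>N\<close>-point
  configuration (with repetitions allowed) is a family of points with indices \<open>0..<N\<close>.
\<close>

definition torus :: "nat \<Rightarrow> (nat \<Rightarrow> real) set" where
  "torus d = {x. \<forall>i\<in>{1..d}. x i \<in> {0..<1}}"

definition tensor_power :: "nat \<Rightarrow> (real \<Rightarrow> real) \<Rightarrow> (nat \<Rightarrow> real) \<Rightarrow> real" where
  "tensor_power d f t = (\<Prod>i=1..d. f (t i))"

definition energy ::
  "((nat \<Rightarrow> real) \<Rightarrow> real) \<Rightarrow> nat \<Rightarrow> (nat \<Rightarrow> nat \<Rightarrow> real) \<Rightarrow> real" where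
  "energy F N X = (\<Sum>k<N. \<Sum>l\<in>{..<N} - {k}. F (\<lambda>i. X k i - X l i))"

text \<open>Addition of \<open>r\<close> takes place in \<open>\<real>/\<int>\<close>, hence the fractional part.\<close>

definition shift_first :: "real \<Rightarrow> (nat \<Rightarrow> nat \<Rightarrow> real) \<Rightarrow> nat \<Rightarrow> nat \<Rightarrow> real" where
  "shift_first r X = X(0 := (X 0)(1 := frac (X 0 1 + r)))"

definition local_min_on :: "real set \<Rightarrow> (real \<Rightarrow> real) \<Rightarrow> real \<Rightarrow> bool" where
  "local_min_on S g a \<longleftrightarrow> a \<in> S \<and> (\<forall>\<^sub>F r in at a within S. g a \<le> g r)"

end

theory Submission
  imports Defs
begin

text \<open>
  Up to a constant, the energy of the shifted configuration is \<open>W f(r) + G(r)\<close> with \<open>W > 0\<close>: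
  the points sharing the first coordinate of the moved point contribute \<open>W f(r)\<close>, the others
  a function \<open>G\<close> differentiable at \<open>0\<close>. Since \<open>f\<close> has a downward cusp at \<open>0\<close>, the symmetric
  second difference at \<open>0\<close> is at most \<open>- c \<bar>r\<bar> + o(r)\<close>, so one of the shifts by \<open>r\<close> and
  \<open>- r\<close> lowers the energy.
\<close>

lemma cusp_not_local_min:
  fixes \<phi> G :: "real \<Rightarrow> real"
  assumes "c > 0" and cusp: "\<forall>\<^sub>F r in at 0. \<phi> r \<le> \<phi> 0 - c * \<bar>r\<bar>"
    and G: "G differentiable (at 0)"
  shows "\<not> (\<forall>\<^sub>F r in at 0. \<phi> 0 + G 0 \<le> \<phi> r + G r)"
proof
  assume min: "\<forall>\<^sub>F r in at 0. \<phi> 0 + G 0 \<le> \<phi> r + G r"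
  obtain D where "(G has_real_derivative D) (at 0)"
    using G by (auto simp: real_differentiable_def)
  then have "((\<lambda>r. (G r - G 0) / r) \<longlongrightarrow> D) (at 0)"
    by (simp add: has_field_derivative_iff)
  then have ev: "\<forall>\<^sub>F r in at 0. dist ((G r - G 0) / r) D < c"
    using \<open>c > 0\<close> by (rule tendstoD)
  have "\<forall>\<^sub>F r in at 0. dist ((G r - G 0) / r) D < c \<and> \<phi> r \<le> \<phi> 0 - c * \<bar>r\<bar> \<and> \<phi> 0 + G 0 \<le> \<phi> r + G r"
    using ev cusp min by eventually_elim simp
  then obtain e where "e > 0" and e: "\<And>r. r \<noteq> 0 \<Longrightarrow> \<bar>r\<bar> < e \<Longrightarrow>
      \<bar>(G r - G 0) / r - D\<bar> < c \<and> \<phi> r \<le> \<phi> 0 - c * \<bar>r\<bar> \<and> \<phi> 0 + G 0 \<le> \<phi> r + G r"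
    by (auto simp: eventually_at dist_real_def)
  define r where "r = e / 2"
  have r: "r > 0" "r < e"
    using \<open>e > 0\<close> by (auto simp: r_def)
  have slope: "\<bar>(G r - G 0) / r - D\<bar> < c" "\<bar>(G (- r) - G 0) / (- r) - D\<bar> < c"
    and incr: "c * r \<le> G r - G 0" "c * r \<le> G (- r) - G 0"
    using e[of r] e[of "- r"] r by auto
  \<comment> \<open>Being within \<open>c\<close> of the same \<open>D\<close>, the two quotients
    differ by less than \<open>2 * c\<close>. Minimality and the cusp bound push them at least
    \<open>2 * c\<close> apart, because dividing by \<open>- r\<close> reverses the second
    inequality.\<close>
  have "c \<le> (G r - G 0) / r" "(G (- r) - G 0) / (- r) \<le> - c"
    using incr r by (simp_all add: field_simps)
  with slope show False
    by linarith
qed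

lemma periodic_of_int:
  fixes f :: "real \<Rightarrow> 'a"
  assumes per: "\<And>t. f (t + 1) = f t"
  shows "f (t + of_int n) = f t"
proof (induction n rule: int_induct[where k = 0])
  case (step1 i)
  then show ?case
    using per[of "t + of_int i"] by (simp add: add.assoc)
next
  case (step2 i)
  then show ?case
    using per[of "t + of_int i - 1"] by (simp add: algebra_simps)
qed simp

text \<open>\<open>frac t\<close> and \<open>t\<close> differ by an integer, so the reduction modulo
  1 in \<open>shift_first\<close> disappears inside \<open>f\<close>.\<close>

lemma periodic_frac_diff:
  fixes f :: "real \<Rightarrow> 'a"
  assumes "\<And>t. f (t + 1) = f t"
  shows "f (frac t - s) = f (t - s)"
  using periodic_of_int[of f "t - s" "- \<lfloor>t\<rfloor>", OF assms] by (simp add: frac_def algebra_simps)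

text \<open>Transfers differentiability from (0,1) to (-1,0), since differences of representatives
  in [0,1) can be negative.\<close>

lemma even_differentiable_uminus:
  fixes f :: "real \<Rightarrow> real"
  assumes "\<And>t. f (- t) = f t" and "f differentiable (at t)"
  shows "f differentiable (at (- t))"
proof -
  obtain D where "(f has_real_derivative D) (at t)"
    using assms(2) by (auto simp: real_differentiable_def)
  then have "((\<lambda>s. f (- s)) has_real_derivative (- D)) (at (- t))"
    using DERIV_mirror[of f D "- t"] by simp
  then show ?thesis
    using assms(1) by (auto simp: real_differentiable_def)
qed

lemma tensor_power_split_first:
  assumes "d \<ge> 1"
  shows "tensor_power d f t = f (t 1) * (\<Prod>i=2..d. f (t i))"
  using assms by (simp add: tensor_power_def prod.atLeast_Suc_atMost numeral_2_eq_2)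

text \<open>Isolates the point with index 0, the only one that moves. By symmetry of
  \<open>F\<close>, each pair containing it is counted twice with the same value.\<close>

lemma energy_split_first:
  assumes sym: "\<And>t. F (\<lambda>i. - t i) = F t"
  shows "energy F (Suc M) X =
    2 * (\<Sum>l=1..M. F (\<lambda>i. X 0 i - X l i))
      + (\<Sum>k=1..M. \<Sum>l\<in>{1..M} - {k}. F (\<lambda>i. X k i - X l i))"
proof -
  let ?a = "\<lambda>k l. F (\<lambda>i. X k i - X l i)"
  have sets: "{..<Suc M} = insert 0 {1..M}"
    by auto
  have swap: "?a k 0 = ?a 0 k" for k
    using sym[of "\<lambda>i. X 0 i - X k i"] by simp
  have "(\<Sum>l\<in>{..<Suc M} - {k}. ?a k l) = ?a 0 k + (\<Sum>l\<in>{1..M} - {k}. ?a k l)"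
    if "k \<in> {1..M}" for k
  proof -
    have "{..<Suc M} - {k} = insert 0 ({1..M} - {k})"
      using that by auto
    then show ?thesis
      by (simp add: swap)
  qed
  moreover have "{..<Suc M} - {0} = {1..M}"
    by auto
  ultimately show ?thesis
    unfolding energy_def by (subst sets) (simp add: sum.distrib)
qed

text \<open>Only the first factor of a pair containing point 0 sees the shift. The other factors
  form weights independent of \<open>r\<close>, and \<open>K\<close> is the mutual energy of the
  fixed points.\<close>

lemma energy_shift_first:
  fixes f :: "real \<Rightarrow> real"
  assumes per: "\<And>t. f (t + 1) = f t" and even: "\<And>t. f (- t) = f t" and "d \<ge> 1"
  obtains K where "\<And>r. energy (tensor_power d f) (Suc M) (shift_first r X) =
    2 * (\<Sum>l=1..M. (\<Prod>i=2..d. f (X 0 i - X l i)) * f (X 0 1 - X l 1 + r)) + K"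
proof
  fix r
  have "tensor_power d f (\<lambda>i. - t i) = tensor_power d f t" for t
    by (simp add: tensor_power_def even)
  note split = energy_split_first[of "tensor_power d f", OF this]
  have "tensor_power d f (\<lambda>i. shift_first r X 0 i - shift_first r X l i) =
      (\<Prod>i=2..d. f (X 0 i - X l i)) * f (X 0 1 - X l 1 + r)" if "l \<in> {1..M}" for l
    using that by (simp add: tensor_power_split_first[OF \<open>d \<ge> 1\<close>] shift_first_def
        periodic_frac_diff[of f, OF per] algebra_simps)
  then have first: "(\<Sum>l=1..M. tensor_power d f (\<lambda>i. shift_first r X 0 i - shift_first r X l i)) =
      (\<Sum>l=1..M. (\<Prod>i=2..d. f (X 0 i - X l i)) * f (X 0 1 - X l 1 + r))"
    by (rule sum.cong[OF refl])
  have "(\<Sum>k=1..M. \<Sum>l\<in>{1..M} - {k}. tensor_power d f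
        (\<lambda>i. shift_first r X k i - shift_first r X l i)) =
      (\<Sum>k=1..M. \<Sum>l\<in>{1..M} - {k}. tensor_power d f (\<lambda>i. X k i - X l i))"
    by (intro sum.cong refl) (simp add: shift_first_def)
  then show "energy (tensor_power d f) (Suc M) (shift_first r X) =
      2 * (\<Sum>l=1..M. (\<Prod>i=2..d. f (X 0 i - X l i)) * f (X 0 1 - X l 1 + r))
      + (\<Sum>k=1..M. \<Sum>l\<in>{1..M} - {k}. tensor_power d f (\<lambda>i. X k i - X l i))"
    by (simp only: split first)
qed

theorem theorem3p1:
  fixes f :: "real \<Rightarrow> real" and d N j :: nat and X :: "nat \<Rightarrow> nat \<Rightarrow> real"
  assumes "continuous_on UNIV f"
    and "\<And>t. f t > 0"
    and "\<And>t. f (t + 1) = f t"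
    and "\<And>t. f (- t) = f t"
    and "\<And>t. 0 < t \<Longrightarrow> t < 1 \<Longrightarrow> f differentiable (at t)"
    and "\<exists>C>0. \<exists>\<epsilon>>0. \<forall>t. 0 \<le> t \<and> t < \<epsilon> \<longrightarrow> f t \<le> f 0 - C * t"
    and "d \<ge> 1"
    and "\<And>k. k < N \<Longrightarrow> X k \<in> torus d"
    and "1 \<le> j" and "j < N"
    and "\<And>k. k \<le> j \<Longrightarrow> X k 1 = X 0 1"
    and "\<And>k. j < k \<Longrightarrow> k < N \<Longrightarrow> X k 1 \<noteq> X 0 1"
  shows "\<not> local_min_on {-1/2..<1/2}
             (\<lambda>r. energy (tensor_power d f) N (shift_first r X)) 0"
proof
  note pos = assms(2) and per = assms(3) and even = assms(4) and diff = assms(5)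
  assume min: "local_min_on {-1/2..<1/2}
      (\<lambda>r. energy (tensor_power d f) N (shift_first r X)) 0"
  obtain M where N: "N = Suc M"
    using \<open>j < N\<close> by (cases N) auto
  define w where "w l = (\<Prod>i=2..d. f (X 0 i - X l i))" for l
  define W where "W = (\<Sum>l=1..j. w l)"
  define G where "G r = (\<Sum>l=Suc j..M. w l * f (X 0 1 - X l 1 + r))" for r
  have "w l > 0" for l
    by (simp add: w_def prod_pos pos)
  \<comment> \<open>\<open>1 \<le> j\<close> makes the sum nonempty: at least one other point shares
    the first coordinate, so the cusp really occurs.\<close>
  then have "W > 0"
    using \<open>1 \<le> j\<close> unfolding W_def by (intro sum_pos) auto
  obtain K where K: "\<And>r. energy (tensor_power d f) N (shift_first r X) =
      2 * (\<Sum>l=1..M. w l * f (X 0 1 - X l 1 + r)) + K"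
    using energy_shift_first[of f d M X, OF per even \<open>d \<ge> 1\<close>] unfolding N w_def by blast
  have "(\<Sum>l=1..M. w l * f (X 0 1 - X l 1 + r)) = W * f r + G r" for r
  proof -
    have "{1..M} = {1..j} \<union> {Suc j..M}" "{1..j} \<inter> {Suc j..M} = {}"
      using \<open>j < N\<close> N by auto
    then have "(\<Sum>l=1..M. w l * f (X 0 1 - X l 1 + r)) =
        (\<Sum>l=1..j. w l * f (X 0 1 - X l 1 + r)) + G r"
      by (simp add: sum.union_disjoint G_def)
    also have "(\<Sum>l=1..j. w l * f (X 0 1 - X l 1 + r)) = W * f r"
      unfolding W_def sum_distrib_right
    proof (rule sum.cong[OF refl])
      show "w l * f (X 0 1 - X l 1 + r) = w l * f r" if "l \<in> {1..j}" for l
        using assms(11)[of l] that by simp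
    qed
    finally show ?thesis .
  qed
  with K have E: "energy (tensor_power d f) N (shift_first r X) = 2 * (W * f r + G r) + K" for r
    by simp
  \<comment> \<open>The difference is nonzero and lies in (-1,1), so either it or its negative lies
    in (0,1).\<close>
  have "f differentiable (at (X 0 1 - X l 1))" if "l \<in> {Suc j..M}" for l
  proof -
    have "X 0 \<in> torus d" "X l \<in> torus d" "X l 1 \<noteq> X 0 1"
      using that N assms(8) assms(12)[of l] by auto
    then have "0 \<le> X 0 1" "X 0 1 < 1" "0 \<le> X l 1" "X l 1 < 1" "X l 1 \<noteq> X 0 1"
      using \<open>d \<ge> 1\<close> by (auto simp: torus_def)
    then show ?thesis
      using diff[of "X 0 1 - X l 1"] diff[of "X l 1 - X 0 1"]
        even_differentiable_uminus[of f "X l 1 - X 0 1", OF even]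
      by (cases "X l 1 < X 0 1") auto
  qed
  then have "(\<lambda>r. f (X 0 1 - X l 1 + r)) differentiable (at 0)" if "l \<in> {Suc j..M}" for l
    using that DERIV_at_within_shift[of f _ "X 0 1 - X l 1" 0 UNIV]
    by (fastforce simp: real_differentiable_def)
  then have G: "G differentiable (at 0)"
    unfolding G_def by (intro differentiable_sum differentiable_mult differentiable_const) auto
  obtain C \<epsilon> where "C > 0" "\<epsilon> > 0" and cusp: "\<And>t. 0 \<le> t \<Longrightarrow> t < \<epsilon> \<Longrightarrow> f t \<le> f 0 - C * t"
    using assms(6) by blast
  have "W * f r \<le> W * f 0 - (W * C) * \<bar>r\<bar>" if "\<bar>r\<bar> < \<epsilon>" for r
  proof -
    \<comment> \<open>Evenness turns the one-sided bound on \<open>f\<close> into a two-sided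
      cusp.\<close>
    have "f r = f \<bar>r\<bar>"
      using even by (simp add: abs_if)
    then have "W * f r \<le> W * (f 0 - C * \<bar>r\<bar>)"
      using cusp[of "\<bar>r\<bar>"] that \<open>W > 0\<close> by simp
    then show ?thesis
      by (simp add: algebra_simps)
  qed
  then have "\<forall>\<^sub>F r in at 0. W * f r \<le> W * f 0 - (W * C) * \<bar>r\<bar>"
    using \<open>\<epsilon> > 0\<close> by (auto simp: eventually_at dist_real_def)
  moreover have "\<forall>\<^sub>F r in at 0. W * f 0 + G 0 \<le> W * f r + G r"
  proof -
    \<comment> \<open>0 is interior to the parameter interval, so shifts of both signs are
      available.\<close>
    have "at (0::real) within {-1/2..<1/2} = at 0"
      by (rule at_within_open_subset[of _ "{-1/2<..<1/2}"]) auto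
    \<comment> \<open>\<open>K\<close> and the factor 2 cancel from the inequality between energies;
      the factor is kept undistributed for this purpose.\<close>
    then show ?thesis
      using min by (simp add: local_min_on_def E del: distrib_left_numeral)
  qed
  ultimately show False
    using cusp_not_local_min[of "W * C" "\<lambda>r. W * f r" G] \<open>W > 0\<close> \<open>C > 0\<close> G by simp
qed

end
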